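(* Let $N\ge 1$ be an integer, $p>1$ and $q>\frac{2p}{p+1}$. Then there exists a constant $c_{N,p,q}>0$, depending only on $N,p,q$, such that for any $M>0$ there is no positive solution $u$ of $$u_t-\Delta u=u^p+M|\nabla u|^q\quad\text{in }\mathbb{R}^N\times(-\infty,0)$$ satisfying $u_t\le 0$ in $\mathbb{R}^N\times(-\infty,0)$ and $$u\ge c_{N,p,q}\,M^{-\frac{2}{(p+1)q-2p}}\quad\text{in }\mathbb{R}^N\times(-\infty,0).$$
   Context: The operators $\nabla$ and $\Delta$ act only on the spatial variable $x$. A solution is a classical solution, i.e. it belongs to $C^{2,1}(\mathbb{R}^N\times(-\infty,0))$ ($C^2$ in $x$, $C^1$ in $t$). *)

theory Defs
  imports "HOL-Analysis.Analysis"
begin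

text \<open>
  Functions of \<open>(x, t)\<close> are total on \<open>real ^ 'n \<times> real\<close>, with \<open>CARD('n)\<close> the dimension \<open>N\<close>; only their
  values for \<open>t < 0\<close> matter below. \<open>deriv\<close> is an arbitrary value where the derivative does not
  exist, which is why \<open>C21_ancient\<close> asserts existence separately from continuity.
\<close>

definition time_deriv :: "(real ^ 'n \<Rightarrow> real \<Rightarrow> real) \<Rightarrow> real ^ 'n \<Rightarrow> real \<Rightarrow> real" where
  "time_deriv u x t = deriv (\<lambda>s. u x s) t"

definition space_deriv :: "'n \<Rightarrow> (real ^ 'n \<Rightarrow> real \<Rightarrow> real) \<Rightarrow> real ^ 'n \<Rightarrow> real \<Rightarrow> real" where
  "space_deriv i u x t = deriv (\<lambda>h. u (x + h *\<^sub>R axis i 1) t) 0"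

definition space_gradient :: "(real ^ 'n \<Rightarrow> real \<Rightarrow> real) \<Rightarrow> real ^ 'n \<Rightarrow> real \<Rightarrow> real ^ 'n" where
  "space_gradient u x t = (\<chi> i. space_deriv i u x t)"

definition space_laplacian :: "(real ^ 'n \<Rightarrow> real \<Rightarrow> real) \<Rightarrow> real ^ 'n \<Rightarrow> real \<Rightarrow> real" where
  "space_laplacian u x t = (\<Sum>i\<in>UNIV. space_deriv i (space_deriv i u) x t)"

definition space_differentiable :: "'n \<Rightarrow> (real ^ 'n \<Rightarrow> real \<Rightarrow> real) \<Rightarrow> bool" where
  "space_differentiable i u \<longleftrightarrow>
     (\<forall>x. \<forall>t<0. (\<lambda>h. u (x + h *\<^sub>R axis i 1) t) differentiable (at 0))"

definition continuous_ancient :: "(real ^ 'n \<Rightarrow> real \<Rightarrow> real) \<Rightarrow> bool" where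
  "continuous_ancient u \<longleftrightarrow> continuous_on (UNIV \<times> {..<0}) (\<lambda>(x, t). u x t)"

text \<open>
  The class \<open>C\<^sup>2\<^sup>,\<^sup>1\<close> on \<open>real ^ 'n \<times> {..<0}\<close>: \<open>u\<close>, its time derivative, and its space derivatives of
  order one and two exist and are jointly continuous in \<open>(x, t)\<close>.
\<close>

definition C21_ancient :: "(real ^ 'n \<Rightarrow> real \<Rightarrow> real) \<Rightarrow> bool" where
  "C21_ancient u \<longleftrightarrow>
     continuous_ancient u \<and>
     (\<forall>x. \<forall>t<0. (\<lambda>s. u x s) differentiable (at t)) \<and>
     continuous_ancient (time_deriv u) \<and>
     (\<forall>i. space_differentiable i u \<and> continuous_ancient (space_deriv i u)) \<and>
     (\<forall>i j. space_differentiable j (space_deriv i u) \<and>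
            continuous_ancient (space_deriv j (space_deriv i u)))"

definition positive_ancient_solution ::
    "real \<Rightarrow> real \<Rightarrow> real \<Rightarrow> (real ^ 'n \<Rightarrow> real \<Rightarrow> real) \<Rightarrow> bool" where
  "positive_ancient_solution p q M u \<longleftrightarrow>
     C21_ancient u \<and>
     (\<forall>x. \<forall>t<0. u x t > 0) \<and>
     (\<forall>x. \<forall>t<0. time_deriv u x t - space_laplacian u x t =
                 u x t powr p + M * norm (space_gradient u x t) powr q)"

end

theory Submission
  imports Defs
begin

text \<open>
  Since \<open>u\<^sub>t \<le> 0\<close>, every time slice satisfies \<open>-\<Delta>u \<ge> u\<^sup>p \<ge> \<delta>\<close> for a constant \<open>\<delta> > 0\<close>, once \<open>u\<close> is
  bounded below by a positive constant. A positive function on the whole space cannot do this: for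
  small \<open>a > 0\<close> the function \<open>u + a |x|\<^sup>2\<close> is coercive, so it attains its minimum, although its
  Laplacian is negative everywhere. Hence every \<open>c > 0\<close> works.
\<close>

text \<open>If \<open>D\<close> were negative, \<open>g'\<close>, which vanishes at the minimum
  \<open>x\<close>, would be negative just to the right of it, and the mean value theorem would give
  a value of \<open>g\<close> below \<open>g x\<close>.\<close>

lemma second_derivative_nonneg_at_minimum:
  fixes g g' :: "real \<Rightarrow> real"
  assumes g: "\<And>h. (g has_real_derivative g' h) (at h)"
    and g': "(g' has_real_derivative D) (at x)"
    and min: "\<And>y. g x \<le> g y"
  shows "D \<ge> 0"
proof (rule ccontr)
  assume "\<not> D \<ge> 0"
  have "g' x = 0"
    using DERIV_local_min[OF g, of 1 x] min by simp
  obtain d where "d > 0" and d: "\<And>h. 0 < h \<Longrightarrow> h < d \<Longrightarrow> g' (x + h) < g' x"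
    using DERIV_neg_dec_right[OF g'] \<open>\<not> D \<ge> 0\<close> by auto
  obtain z where z: "x < z" "z < x + d/2" "g (x + d/2) - g x = (x + d/2 - x) * g' z"
    using MVT2[of x "x + d/2" g g'] g \<open>d > 0\<close> by auto
  have "g' z < 0"
    using d[of "z - x"] z \<open>d > 0\<close> \<open>g' x = 0\<close> by simp
  then have "g (x + d/2) < g x"
    using z(3) mult_pos_neg[of "d/2" "g' z"] \<open>d > 0\<close> by simp
  with min show False
    by (simp add: not_le[symmetric])
qed

lemma coercive_perturbation_attains_minimum:
  fixes v :: "'a::euclidean_space \<Rightarrow> real"
  assumes "continuous_on UNIV v" and "\<And>x. v x > 0" and "a > 0"
  obtains x0 where "\<And>x. v x0 + a * (norm x0)\<^sup>2 \<le> v x + a * (norm x)\<^sup>2"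
proof -
  \<comment> \<open>With this radius \<open>a * R\<^sup>2\<close> equals \<open>v 0\<close>, the
    value of the perturbed function at the origin. Outside the ball the quadratic term alone is at
    least that large, so a minimum over the compact ball is a global one.\<close>
  define R where "R = sqrt (v 0 / a)"
  have "R \<ge> 0" and R: "a * R\<^sup>2 = v 0"
    using assms(2)[of 0] \<open>a > 0\<close> by (simp_all add: R_def)
  have "continuous_on (cball 0 R) (\<lambda>x. v x + a * (norm x)\<^sup>2)"
    by (intro continuous_intros continuous_on_subset[OF assms(1)]) auto
  then obtain x0 where x0: "\<And>x. norm x \<le> R \<Longrightarrow> v x0 + a * (norm x0)\<^sup>2 \<le> v x + a * (norm x)\<^sup>2"
    using continuous_attains_inf[of "cball 0 R" "\<lambda>x. v x + a * (norm x)\<^sup>2"] \<open>R \<ge> 0\<close>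
    by (metis compact_cball mem_cball_0 empty_iff norm_zero)
  show thesis
  proof (rule that)
    fix x
    show "v x0 + a * (norm x0)\<^sup>2 \<le> v x + a * (norm x)\<^sup>2"
    proof (cases "norm x \<le> R")
      case False
      then have "a * R\<^sup>2 \<le> a * (norm x)\<^sup>2"
        using \<open>R \<ge> 0\<close> \<open>a > 0\<close> by (simp add: power_mono)
      then show ?thesis
        using x0[of 0] R assms(2)[of x] \<open>R \<ge> 0\<close> by simp
    qed (rule x0)
  qed
qed

text \<open>\<open>space_deriv\<close> is a derivative at \<open>0\<close> along a line starting at
  the base point. Moving the base point along the axis turns it into a derivative at every
  \<open>h\<close>, so that one-variable calculus applies to the restriction of \<open>u\<close> to
  the line.\<close>

lemma space_deriv_along_axis:
  assumes "space_differentiable i u" and "t < 0"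
  shows "((\<lambda>h. u (x + h *\<^sub>R axis i 1) t) has_real_derivative space_deriv i u (x + h *\<^sub>R axis i 1) t) (at h)"
proof -
  have "((\<lambda>k. u ((x + h *\<^sub>R axis i 1) + k *\<^sub>R axis i 1) t) has_real_derivative
      space_deriv i u (x + h *\<^sub>R axis i 1) t) (at 0)"
    using assms unfolding space_differentiable_def space_deriv_def
    by (simp add: DERIV_deriv_iff_real_differentiable)
  then show ?thesis
    using DERIV_shift[of "\<lambda>h. u (x + h *\<^sub>R axis i 1) t" _ 0 h]
    by (simp add: scaleR_add_left add_ac)
qed

lemma norm_add_axis_power2:
  fixes x :: "real ^ 'n"
  shows "(norm (x + h *\<^sub>R axis i 1))\<^sup>2 = (norm x)\<^sup>2 + 2 * h * x $ i + h\<^sup>2"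
  unfolding power2_norm_eq_inner
  by (simp add: inner_add_left inner_add_right inner_axis inner_axis' power2_eq_square algebra_simps)

text \<open>At a minimum of \<open>u + a |x|\<^sup>2\<close> every pure second derivative of
  \<open>u\<close> is at least \<open>- 2 * a\<close>; summing over the axes bounds the Laplacian
  from below there.\<close>

lemma positive_laplacian_not_uniformly_negative:
  fixes u :: "real ^ 'n \<Rightarrow> real \<Rightarrow> real"
  assumes u: "C21_ancient u" and "t < 0" and pos: "\<And>x. u x t > 0" and "\<delta> > 0"
  shows "\<exists>x. space_laplacian u x t > - \<delta>"
proof -
  \<comment> \<open>The bounds \<open>- 2 * a\<close> from all axes add up to
    \<open>- \<delta> / 2\<close>, which leaves room for the strict inequality.\<close>
  define a where "a = \<delta> / (4 * real CARD('n))"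
  have "a > 0"
    using \<open>\<delta> > 0\<close> by (simp add: a_def)
  have "continuous_on UNIV ((\<lambda>(x, t). u x t) \<circ> (\<lambda>x. (x, t)))"
    using u \<open>t < 0\<close> unfolding C21_ancient_def continuous_ancient_def
    by (intro continuous_on_compose continuous_intros) (auto elim: continuous_on_subset)
  then have cont: "continuous_on UNIV (\<lambda>x. u x t)"
    by (simp add: comp_def)
  obtain x0 where x0: "\<And>x. u x0 t + a * (norm x0)\<^sup>2 \<le> u x t + a * (norm x)\<^sup>2"
    using coercive_perturbation_attains_minimum[OF cont pos \<open>a > 0\<close>] by blast
  \<comment> \<open>The one-variable criterion is applied to the perturbed function on the line
    through \<open>x0\<close> along axis \<open>i\<close>, where the minimum sits at
    \<open>h = 0\<close>.\<close>
  have "space_deriv i (space_deriv i u) x0 t + 2 * a \<ge> 0" for i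
  proof (rule second_derivative_nonneg_at_minimum)
    fix h
    show "((\<lambda>h. u (x0 + h *\<^sub>R axis i 1) t + a * (norm (x0 + h *\<^sub>R axis i 1))\<^sup>2) has_real_derivative
        space_deriv i u (x0 + h *\<^sub>R axis i 1) t + 2 * a * (x0 $ i + h)) (at h)"
      unfolding norm_add_axis_power2 using u \<open>t < 0\<close>
      by (auto intro!: derivative_eq_intros space_deriv_along_axis
          simp: C21_ancient_def algebra_simps)
  next
    show "((\<lambda>h. space_deriv i u (x0 + h *\<^sub>R axis i 1) t + 2 * a * (x0 $ i + h)) has_real_derivative
        space_deriv i (space_deriv i u) x0 t + 2 * a) (at 0)"
      using u \<open>t < 0\<close> space_deriv_along_axis[of i "space_deriv i u" t x0 0]
      by (auto intro!: derivative_eq_intros simp: C21_ancient_def)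
  qed (use x0 in simp)
  then have "0 \<le> (\<Sum>i\<in>UNIV. space_deriv i (space_deriv i u) x0 t + 2 * a)"
    by (intro sum_nonneg) auto
  also have "\<dots> = space_laplacian u x0 t + \<delta> / 2"
    by (simp add: space_laplacian_def sum.distrib a_def)
  finally show ?thesis
    using \<open>\<delta> > 0\<close> by (intro exI[of _ x0]) simp
qed

theorem theorem1p7:
  fixes p q :: real
  assumes "p > 1" and "q > 2 * p / (p + 1)"
  shows "\<exists>c>0. \<forall>M>0.
    \<not> (\<exists>u :: real ^ 'n \<Rightarrow> real \<Rightarrow> real.
          positive_ancient_solution p q M u \<and>
          (\<forall>x. \<forall>t<0. time_deriv u x t \<le> 0) \<and>
          (\<forall>x. \<forall>t<0. u x t \<ge> c * M powr (- (2 / ((p + 1) * q - 2 * p)))))"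
proof (intro exI[of _ 1] conjI allI impI notI)
  fix M :: real
  assume "M > 0" and "\<exists>u :: real ^ 'n \<Rightarrow> real \<Rightarrow> real.
          positive_ancient_solution p q M u \<and>
          (\<forall>x. \<forall>t<0. time_deriv u x t \<le> 0) \<and>
          (\<forall>x. \<forall>t<0. u x t \<ge> 1 * M powr (- (2 / ((p + 1) * q - 2 * p))))"
  then obtain u :: "real ^ 'n \<Rightarrow> real \<Rightarrow> real"
    where sol: "positive_ancient_solution p q M u"
      and decr: "\<forall>x. \<forall>t<0. time_deriv u x t \<le> 0"
      and lower: "\<forall>x. \<forall>t<0. u x t \<ge> M powr (- (2 / ((p + 1) * q - 2 * p)))"
    by auto
  \<comment> \<open>This is the assumed lower bound on \<open>u\<close> for the choice
    \<open>c = 1\<close>. It is positive, so \<open>m powr p\<close> can serve as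
    \<open>\<delta>\<close>.\<close>
  define m where "m = M powr (- (2 / ((p + 1) * q - 2 * p)))"
  have "m > 0"
    using \<open>M > 0\<close> by (simp add: m_def)
  \<comment> \<open>The time \<open>-1\<close> stands for any negative time. At this
    \<open>x\<close> the equation and \<open>time_deriv u x (-1) \<le> 0\<close> force the Laplacian
    to be at most \<open>- (m powr p)\<close>, a contradiction.\<close>
  obtain x where x: "space_laplacian u x (-1) > - (m powr p)"
    using positive_laplacian_not_uniformly_negative[of u "-1" "m powr p"] sol \<open>m > 0\<close>
    by (auto simp: positive_ancient_solution_def)
  have "m powr p \<le> u x (-1) powr p"
    using lower \<open>m > 0\<close> \<open>p > 1\<close> by (intro powr_mono2) (auto simp: m_def)
  moreover have "M * norm (space_gradient u x (-1)) powr q \<ge> 0"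
    using \<open>M > 0\<close> by simp
  moreover have "time_deriv u x (-1) - space_laplacian u x (-1) =
      u x (-1) powr p + M * norm (space_gradient u x (-1)) powr q"
    using sol by (simp add: positive_ancient_solution_def)
  moreover have "time_deriv u x (-1) \<le> 0"
    using decr by simp
  ultimately show False
    using x by linarith
qed simp

end
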